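(* Let $Z,X,V$ be the bidiagonal operators on $\mathcal V_N$ defined in the context, $Z^\top,X^\top,V^\top$ their transposes, and $W=X-[\mu]_qZ$. Assume no denominator below vanishes. Then the solutions to the following generalized eigenvalue problems (GEVPs) and eigenvalue problems (EVPs) are given as follows, $n=0,1,\dots,N$: in each case the listed scalars are exactly the (generalized) eigenvalues, and the listed vector is, up to a scalar multiple, the corresponding (generalized) eigenvector. (1) $X|d_n\rangle=\lambda_nZ|d_n\rangle$ with $\lambda_n=[\alpha-n]_q$ and $$|d_n\rangle=\sum_{\ell=0}^N\frac{a_na_{n+1}\cdots a_{N-1}}{a_\ell a_{\ell+1}\cdots a_{N-1}}\frac{(q^{n-N};q)_{N-\ell}}{(q^{n-N};q)_{N-n}}\frac{(q^{n-N-\alpha+\beta+1};q)_{N-n}}{(q^{n-N-\alpha+\beta+1};q)_{N-\ell}}|\ell\rangle;$$ (2) $X^\top|d_n^*\rangle=\lambda_nZ^\top|d_n^*\rangle$ with $\lambda_n=[\alpha-n]_q$ and $$|d_n^*\rangle=\sum_{\ell=0}^N\frac{a_0\cdots a_{n-1}}{a_0\cdots a_{\ell-1}}\frac{q^{(\beta-\alpha)n}}{q^{(\beta-\alpha)\ell}}\frac{(q^{-n};q)_\ell}{(q^{-n};q)_n}\frac{(q^{-n+\alpha-\beta};q)_n}{(q^{-n+\alpha-\beta};q)_\ell}|\ell\rangle;$$ (3) $V|e_n\rangle=\nu_n|e_n\rangle$ with $\nu_n=[n-\beta]_q[\beta-n+1]_q$ and $$|e_n\rangle=\sum_{\ell=0}^N\frac{a_0\cdots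 a_{\ell-1}}{a_0\cdots a_{n-1}}\frac{q^{(\alpha-\beta-1)n}}{q^{(\alpha-\beta-1)\ell}}\frac{(q^{-n};q)_\ell}{(q^{-n};q)_n}\frac{(q;q)_n}{(q;q)_\ell}\frac{(q^{-N};q)_n}{(q^{-N};q)_\ell}\frac{(q^{n-2\beta-1};q)_\ell}{(q^{n-2\beta-1};q)_n}|\ell\rangle;$$ (4) $V^\top|e_n^*\rangle=\nu_n|e_n^*\rangle$ with $\nu_n=[n-\beta]_q[\beta-n+1]_q$ and $$|e_n^*\rangle=\sum_{\ell=0}^N\frac{a_\ell\cdots a_{N-1}}{a_n\cdots a_{N-1}}\frac{q^{(\alpha+\beta-N)(N-n)}}{q^{(\alpha+\beta-N)(N-\ell)}}\frac{(q^{n-N};q)_{N-\ell}}{(q^{n-N};q)_{N-n}}\frac{(q;q)_{N-n}}{(q;q)_{N-\ell}}\frac{(q^{-N};q)_{N-n}}{(q^{-N};q)_{N-\ell}}\frac{(q^{-N-n+2\beta+1};q)_{N-\ell}}{(q^{-N-n+2\beta+1};q)_{N-n}}|\ell\rangle;$$ (5) $W|f_n\rangle=\rho_n|f_n\rangle$ with $\rho_n=-[\alpha-n]_q+[\mu]_q$ and $$|f_n\rangle=\sum_{\ell=0}^N\frac{a_n\cdots a_{N-1}}{a_\ell\cdots a_{N-1}}\frac{q^{(\alpha-\mu-n)(N-\ell)}}{q^{(\alpha-\mu-n)(N-n)}}\frac{(q^{n-N};q)_{N-\ell}}{(q^{n-N};q)_{N-n}}\frac{(q^{\beta-\mu-N+1};q)_{N-n}}{(q^{\beta-\mu-N+1};q)_{N-\ell}}|\ell\rangle;$$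 (6) $W^\top|f_n^*\rangle=\rho_n|f_n^*\rangle$ with $\rho_n=-[\alpha-n]_q+[\mu]_q$ and $$|f_n^*\rangle=\sum_{\ell=0}^N\frac{a_0\cdots a_{n-1}}{a_0\cdots a_{\ell-1}}\frac{q^{(\beta-\alpha)n}}{q^{(\beta-\alpha)\ell}}\frac{(q^{-n};q)_\ell}{(q^{-n};q)_n}\frac{(q^{\mu-\beta};q)_n}{(q^{\mu-\beta};q)_\ell}|\ell\rangle.$$
   Context: $q$ is real, $q>0$, $q\ne1$; $[x]_q=\frac{1-q^x}{1-q}$; $(a;q)_0=1$, $(a;q)_k=\prod_{i=0}^{k-1}(1-aq^i)$ for $k\ge1$. $N$ is a positive integer, $\alpha,\beta,\mu$ are real parameters, $a_0,\dots,a_{N-1}$ are nonzero real constants and $a_{-1}=a_N=0$. Empty products equal $1$. $\mathcal V_N$ is a real vector space of dimension $N+1$ with a scalar product and orthonormal basis $\{|n\rangle\}_{n=0}^N$, $\langle m|n\rangle=\delta_{mn}$. The operators $Z,X,V$ (a representation of the meta $q$-Hahn algebra) act by $$Z|n\rangle=-|n\rangle+a_n|n+1\rangle,\quad X|n\rangle=-[\alpha-n]_q|n\rangle+a_n[\beta-n]_q|n+1\rangle,$$ $$V|n\rangle=[n-\beta]_q[\beta-n+1]_q|n\rangle-\frac{q^{\alpha-N}[n]_q[N+1-n]_q}{a_{n-1}}|n-1\rangle,$$ with no $|n+1\rangle$ term for $n=N$ and no $|n-1\rangle$ term for $n=0$. The transpose is defined by $\langle v|O^\top|w\rangle=\langle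 w|O|v\rangle$. A generalized eigenvalue of a pair $(A,B)$ is a scalar $\lambda$ for which $A|v\rangle=\lambda B|v\rangle$ has a nonzero solution $|v\rangle$. The nonvanishing-denominator assumption holds for instance if $\alpha-\beta$, $2\beta$ and $\beta-\mu$ are not integers. *)

theory Defs
  imports "HOL-Analysis.Analysis"
begin

definition qnum :: "real \<Rightarrow> real \<Rightarrow> real" where
  "qnum q x = (1 - q powr x) / (1 - q)"

definition qpoch :: "real \<Rightarrow> real \<Rightarrow> nat \<Rightarrow> real" where
  "qpoch x q k = (\<Prod>i<k. 1 - x * q ^ i)"

definition gen_eigenvector :: "('a::real_vector \<Rightarrow> 'a) \<Rightarrow> ('a \<Rightarrow> 'a) \<Rightarrow> real \<Rightarrow> 'a \<Rightarrow> bool" where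
  "gen_eigenvector A B l v \<longleftrightarrow> v \<noteq> 0 \<and> A v = l *\<^sub>R B v"

definition gen_eigenvalue :: "('a::real_vector \<Rightarrow> 'a) \<Rightarrow> ('a \<Rightarrow> 'a) \<Rightarrow> real \<Rightarrow> bool" where
  "gen_eigenvalue A B l \<longleftrightarrow> (\<exists>v. gen_eigenvector A B l v)"

definition gevp_solution ::
  "('a::real_vector \<Rightarrow> 'a) \<Rightarrow> ('a \<Rightarrow> 'a) \<Rightarrow> nat \<Rightarrow> (nat \<Rightarrow> real) \<Rightarrow> (nat \<Rightarrow> 'a) \<Rightarrow> bool" where
  "gevp_solution A B N l v \<longleftrightarrow>
     {x. gen_eigenvalue A B x} = l ` {..N} \<and>
     (\<forall>n\<le>N. {u. gen_eigenvector A B (l n) u} = {c *\<^sub>R v n | c. c \<noteq> 0})"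

definition evp_solution ::
  "('a::real_vector \<Rightarrow> 'a) \<Rightarrow> nat \<Rightarrow> (nat \<Rightarrow> real) \<Rightarrow> (nat \<Rightarrow> 'a) \<Rightarrow> bool" where
  "evp_solution A N l v \<longleftrightarrow> gevp_solution A (\<lambda>u. u) N l v"

definition is_orthonormal_basis :: "nat \<Rightarrow> (nat \<Rightarrow> 'a::euclidean_space) \<Rightarrow> bool" where
  "is_orthonormal_basis N ket \<longleftrightarrow>
     (\<forall>m\<le>N. \<forall>n\<le>N. ket m \<bullet> ket n = (if m = n then 1 else 0)) \<and>
     span (ket ` {..N}) = UNIV"

(* The boundary conventions a_{-1} = a_N = 0 are encoded by the conditionals: the values of
   ket beyond N and of a outside {0..<N} never enter. *)
definition meta_qHahn_rep ::
  "real \<Rightarrow> nat \<Rightarrow> real \<Rightarrow> real \<Rightarrow> (nat \<Rightarrow> real) \<Rightarrow> (nat \<Rightarrow> 'a::euclidean_space) \<Rightarrow>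
     ('a \<Rightarrow> 'a) \<Rightarrow> ('a \<Rightarrow> 'a) \<Rightarrow> ('a \<Rightarrow> 'a) \<Rightarrow> bool" where
  "meta_qHahn_rep q N \<alpha> \<beta> a ket Z X V \<longleftrightarrow>
     linear Z \<and> linear X \<and> linear V \<and>
     (\<forall>n\<le>N.
        Z (ket n) = - ket n + (if n < N then a n *\<^sub>R ket (n + 1) else 0) \<and>
        X (ket n) = - qnum q (\<alpha> - real n) *\<^sub>R ket n
          + (if n < N then (a n * qnum q (\<beta> - real n)) *\<^sub>R ket (n + 1) else 0) \<and>
        V (ket n) = (qnum q (real n - \<beta>) * qnum q (\<beta> - real n + 1)) *\<^sub>R ket n
          - (if 0 < n then
               (q powr (\<alpha> - real N) * qnum q (real n) * qnum q (real N + 1 - real n) / a (n - 1))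
                 *\<^sub>R ket (n - 1)
             else 0))"

(* Only denominators that can vanish are listed. The other ones are products of a_0, ..., a_{N-1},
   powers of q, and q-shifted factorials whose factors are 1 - q^k with k a nonzero integer. *)
definition nonvanishing_denominators :: "real \<Rightarrow> nat \<Rightarrow> real \<Rightarrow> real \<Rightarrow> real \<Rightarrow> bool" where
  "nonvanishing_denominators q N \<alpha> \<beta> \<mu> \<longleftrightarrow>
     (\<forall>n\<le>N. \<forall>l\<le>N.
        qpoch (q powr (real n - real N - \<alpha> + \<beta> + 1)) q (N - l) \<noteq> 0 \<and>
        qpoch (q powr (- real n + \<alpha> - \<beta>)) q l \<noteq> 0 \<and>
        qpoch (q powr (real n - 2 * \<beta> - 1)) q n \<noteq> 0 \<and>
        qpoch (q powr (- real N - real n + 2 * \<beta> + 1)) q (N - n) \<noteq> 0 \<and>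
        qpoch (q powr (\<beta> - \<mu> - real N + 1)) q (N - l) \<noteq> 0 \<and>
        qpoch (q powr (\<mu> - \<beta>)) q l \<noteq> 0)"

definition d_vec :: "real \<Rightarrow> nat \<Rightarrow> real \<Rightarrow> real \<Rightarrow> (nat \<Rightarrow> real) \<Rightarrow> (nat \<Rightarrow> 'a::euclidean_space) \<Rightarrow> nat \<Rightarrow> 'a" where
  "d_vec q N \<alpha> \<beta> a ket n = (\<Sum>l\<le>N.
     ((\<Prod>i\<in>{n..<N}. a i) / (\<Prod>i\<in>{l..<N}. a i)
      * (qpoch (q powr (real n - real N)) q (N - l)
         / qpoch (q powr (real n - real N)) q (N - n))
      * (qpoch (q powr (real n - real N - \<alpha> + \<beta> + 1)) q (N - n)
         / qpoch (q powr (real n - real N - \<alpha> + \<beta> + 1)) q (N - l))) *\<^sub>R ket l)"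

definition dstar_vec :: "real \<Rightarrow> nat \<Rightarrow> real \<Rightarrow> real \<Rightarrow> (nat \<Rightarrow> real) \<Rightarrow> (nat \<Rightarrow> 'a::euclidean_space) \<Rightarrow> nat \<Rightarrow> 'a" where
  "dstar_vec q N \<alpha> \<beta> a ket n = (\<Sum>l\<le>N.
     ((\<Prod>i<n. a i) / (\<Prod>i<l. a i)
      * (q powr ((\<beta> - \<alpha>) * real n) / q powr ((\<beta> - \<alpha>) * real l))
      * (qpoch (q powr (- real n)) q l / qpoch (q powr (- real n)) q n)
      * (qpoch (q powr (- real n + \<alpha> - \<beta>)) q n
         / qpoch (q powr (- real n + \<alpha> - \<beta>)) q l)) *\<^sub>R ket l)"

definition e_vec :: "real \<Rightarrow> nat \<Rightarrow> real \<Rightarrow> real \<Rightarrow> (nat \<Rightarrow> real) \<Rightarrow> (nat \<Rightarrow> 'a::euclidean_space) \<Rightarrow> nat \<Rightarrow> 'a" where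
  "e_vec q N \<alpha> \<beta> a ket n = (\<Sum>l\<le>N.
     ((\<Prod>i<l. a i) / (\<Prod>i<n. a i)
      * (q powr ((\<alpha> - \<beta> - 1) * real n) / q powr ((\<alpha> - \<beta> - 1) * real l))
      * (qpoch (q powr (- real n)) q l / qpoch (q powr (- real n)) q n)
      * (qpoch q q n / qpoch q q l)
      * (qpoch (q powr (- real N)) q n / qpoch (q powr (- real N)) q l)
      * (qpoch (q powr (real n - 2 * \<beta> - 1)) q l
         / qpoch (q powr (real n - 2 * \<beta> - 1)) q n)) *\<^sub>R ket l)"

definition estar_vec :: "real \<Rightarrow> nat \<Rightarrow> real \<Rightarrow> real \<Rightarrow> (nat \<Rightarrow> real) \<Rightarrow> (nat \<Rightarrow> 'a::euclidean_space) \<Rightarrow> nat \<Rightarrow> 'a" where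
  "estar_vec q N \<alpha> \<beta> a ket n = (\<Sum>l\<le>N.
     ((\<Prod>i\<in>{l..<N}. a i) / (\<Prod>i\<in>{n..<N}. a i)
      * (q powr ((\<alpha> + \<beta> - real N) * (real N - real n))
         / q powr ((\<alpha> + \<beta> - real N) * (real N - real l)))
      * (qpoch (q powr (real n - real N)) q (N - l)
         / qpoch (q powr (real n - real N)) q (N - n))
      * (qpoch q q (N - n) / qpoch q q (N - l))
      * (qpoch (q powr (- real N)) q (N - n) / qpoch (q powr (- real N)) q (N - l))
      * (qpoch (q powr (- real N - real n + 2 * \<beta> + 1)) q (N - l)
         / qpoch (q powr (- real N - real n + 2 * \<beta> + 1)) q (N - n))) *\<^sub>R ket l)"

definition f_vec :: "real \<Rightarrow> nat \<Rightarrow> real \<Rightarrow> real \<Rightarrow> real \<Rightarrow> (nat \<Rightarrow> real) \<Rightarrow> (nat \<Rightarrow> 'a::euclidean_space) \<Rightarrow> nat \<Rightarrow> 'a" where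
  "f_vec q N \<alpha> \<beta> \<mu> a ket n = (\<Sum>l\<le>N.
     ((\<Prod>i\<in>{n..<N}. a i) / (\<Prod>i\<in>{l..<N}. a i)
      * (q powr ((\<alpha> - \<mu> - real n) * (real N - real l))
         / q powr ((\<alpha> - \<mu> - real n) * (real N - real n)))
      * (qpoch (q powr (real n - real N)) q (N - l)
         / qpoch (q powr (real n - real N)) q (N - n))
      * (qpoch (q powr (\<beta> - \<mu> - real N + 1)) q (N - n)
         / qpoch (q powr (\<beta> - \<mu> - real N + 1)) q (N - l))) *\<^sub>R ket l)"

definition fstar_vec :: "real \<Rightarrow> nat \<Rightarrow> real \<Rightarrow> real \<Rightarrow> real \<Rightarrow> (nat \<Rightarrow> real) \<Rightarrow> (nat \<Rightarrow> 'a::euclidean_space) \<Rightarrow> nat \<Rightarrow> 'a" where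
  "fstar_vec q N \<alpha> \<beta> \<mu> a ket n = (\<Sum>l\<le>N.
     ((\<Prod>i<n. a i) / (\<Prod>i<l. a i)
      * (q powr ((\<beta> - \<alpha>) * real n) / q powr ((\<beta> - \<alpha>) * real l))
      * (qpoch (q powr (- real n)) q l / qpoch (q powr (- real n)) q n)
      * (qpoch (q powr (\<mu> - \<beta>)) q n / qpoch (q powr (\<mu> - \<beta>)) q l)) *\<^sub>R ket l)"

end

theory Submission
  imports Defs
begin

text \<open>All six pencils are bidiagonal in the orthonormal basis, with the listed scalars as the
  pairwise distinct ratios of their diagonal entries. The lowest nonzero coordinate of a generalized
  eigenvector (highest, in the upper triangular case) forces the eigenvalue to be the ratio at
  that position. Hence two eigenvectors for the same eigenvalue are proportional: subtracting
  multiples to kill that coordinate leaves zero. It remains to check that the listed coefficients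
  satisfy the resulting two-term recurrences.\<close>

section \<open>Bidiagonal pencils\<close>

text \<open>Only the lower triangular case is argued directly: reversing the order of the basis
  turns an upper bidiagonal pencil into a lower one, and transposition exchanges the two shapes. The
  listed coefficients are telescoped ratios of matrix entries. A difference of two q-numbers, or of
  two eigenvalues of V, is a power of q times one or two factors 1 - q^x, and each such factor is
  the newest factor of one of the q-shifted factorials. The powers of q left over at every step
  accumulate to the explicit powers in the vectors. Triangularity comes from (q^(-n);q)_l, which
  vanishes exactly when l > n. The recurrences are therefore kept multiplied out: a coefficient or a
  factor in them may be zero, and only factors known to be nonzero are divided by. For V the
  denominator assumption does double duty: it makes the vectors meaningful and also keeps the
  eigenvalues apart.\<close>

definition lower_bidiagonal ::
  "nat \<Rightarrow> (nat \<Rightarrow> 'a::euclidean_space) \<Rightarrow> ('a \<Rightarrow> 'a) \<Rightarrow> (nat \<Rightarrow> real) \<Rightarrow> (nat \<Rightarrow> real) \<Rightarrow> bool" where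
  "lower_bidiagonal N ket A d s \<longleftrightarrow> linear A \<and>
     (\<forall>n\<le>N. A (ket n) = d n *\<^sub>R ket n + (if n < N then s n *\<^sub>R ket (Suc n) else 0))"

text \<open>The entry \<open>s k\<close> sits in row \<open>k\<close> and column \<open>k + 1\<close>, so that transposition keeps \<open>s\<close>.\<close>

definition upper_bidiagonal ::
  "nat \<Rightarrow> (nat \<Rightarrow> 'a::euclidean_space) \<Rightarrow> ('a \<Rightarrow> 'a) \<Rightarrow> (nat \<Rightarrow> real) \<Rightarrow> (nat \<Rightarrow> real) \<Rightarrow> bool" where
  "upper_bidiagonal N ket A d s \<longleftrightarrow> linear A \<and>
     (\<forall>n\<le>N. A (ket n) = d n *\<^sub>R ket n + (if 0 < n then s (n - 1) *\<^sub>R ket (n - 1) else 0))"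

section \<open>Coordinates in an orthonormal basis\<close>

lemma onb_inner:
  assumes "is_orthonormal_basis N ket" "m \<le> N" "n \<le> N"
  shows "ket m \<bullet> ket n = (if m = n then 1 else 0)"
  using assms by (simp add: is_orthonormal_basis_def)

lemma onb_eqI:
  fixes ket :: "nat \<Rightarrow> 'a::euclidean_space"
  assumes onb: "is_orthonormal_basis N ket"
    and eq: "\<And>k. k \<le> N \<Longrightarrow> v \<bullet> ket k = w \<bullet> ket k"
  shows "v = w"
proof -
  have "orthogonal (v - w) y" if "y \<in> ket ` {..N}" for y
    using that eq by (auto simp: orthogonal_def inner_diff_left)
  moreover have "v - w \<in> span (ket ` {..N})"
    using onb by (simp add: is_orthonormal_basis_def)
  ultimately have "orthogonal (v - w) (v - w)"
    by (rule orthogonal_to_span[rotated])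
  then show ?thesis
    by (simp add: orthogonal_def)
qed

lemma onb_coordinate:
  fixes ket :: "nat \<Rightarrow> 'a::euclidean_space"
  assumes "is_orthonormal_basis N ket" "j \<le> N"
  shows "(\<Sum>k\<le>N. x k *\<^sub>R ket k) \<bullet> ket j = x j"
proof -
  have "(\<Sum>k\<le>N. x k *\<^sub>R ket k) \<bullet> ket j = (\<Sum>k\<le>N. if k = j then x k else 0)"
    unfolding inner_sum_left using assms by (intro sum.cong) (auto simp: onb_inner)
  also have "\<dots> = x j"
    using assms by simp
  finally show ?thesis .
qed

lemma onb_reverse:
  assumes "is_orthonormal_basis N ket"
  shows "is_orthonormal_basis N (\<lambda>k. ket (N - k))"
proof -
  have "ket y \<in> (\<lambda>k. ket (N - k)) ` {..N}" if "y \<le> N" for y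
    using that by (intro image_eqI[of _ _ "N - y"]) auto
  then have "(\<lambda>k. ket (N - k)) ` {..N} = ket ` {..N}"
    by auto
  with assms show ?thesis
    by (auto simp: is_orthonormal_basis_def)
qed

section \<open>Reversal and transposition of bidiagonal operators\<close>

text \<open>Position \<open>k\<close> of the reversed basis is linked to position
  \<open>Suc k\<close>, that is, \<open>ket (N - k)\<close> to \<open>ket (N - Suc k)\<close>. The
  entry is indexed by the smaller original index, hence the shift in \<open>s (N - Suc k)\<close>
  but not in \<open>d (N - k)\<close>.\<close>

lemma upper_bidiagonal_reverse:
  assumes "upper_bidiagonal N ket A d s"
  shows "lower_bidiagonal N (\<lambda>k. ket (N - k)) A (\<lambda>k. d (N - k)) (\<lambda>k. s (N - Suc k))"
  using assms by (auto simp: upper_bidiagonal_def lower_bidiagonal_def)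

lemma lower_bidiagonal_adjoint:
  assumes onb: "is_orthonormal_basis N ket" and A: "lower_bidiagonal N ket A d s"
  shows "upper_bidiagonal N ket (adjoint A) d s"
  unfolding upper_bidiagonal_def
proof (intro conjI allI impI)
  show "linear (adjoint A)"
    using A by (simp add: lower_bidiagonal_def adjoint_linear)
  fix n assume n: "n \<le> N"
  show "adjoint A (ket n) = d n *\<^sub>R ket n + (if 0 < n then s (n - 1) *\<^sub>R ket (n - 1) else 0)"
  proof (rule onb_eqI[OF onb])
    fix k assume k: "k \<le> N"
    have "adjoint A (ket n) \<bullet> ket k = A (ket k) \<bullet> ket n"
      using A by (simp add: lower_bidiagonal_def adjoint_works inner_commute)
    then show "adjoint A (ket n) \<bullet> ket k
        = (d n *\<^sub>R ket n + (if 0 < n then s (n - 1) *\<^sub>R ket (n - 1) else 0)) \<bullet> ket k"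
      using A n k by (auto simp: lower_bidiagonal_def inner_add_left onb_inner[OF onb])
  qed
qed

lemma upper_bidiagonal_adjoint:
  assumes onb: "is_orthonormal_basis N ket" and A: "upper_bidiagonal N ket A d s"
  shows "lower_bidiagonal N ket (adjoint A) d s"
  unfolding lower_bidiagonal_def
proof (intro conjI allI impI)
  show "linear (adjoint A)"
    using A by (simp add: upper_bidiagonal_def adjoint_linear)
  fix n assume n: "n \<le> N"
  show "adjoint A (ket n) = d n *\<^sub>R ket n + (if n < N then s n *\<^sub>R ket (Suc n) else 0)"
  proof (rule onb_eqI[OF onb])
    fix k assume k: "k \<le> N"
    have "adjoint A (ket n) \<bullet> ket k = A (ket k) \<bullet> ket n"
      using A by (simp add: upper_bidiagonal_def adjoint_works inner_commute)
    then show "adjoint A (ket n) \<bullet> ket k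
        = (d n *\<^sub>R ket n + (if n < N then s n *\<^sub>R ket (Suc n) else 0)) \<bullet> ket k"
      using A n k by (auto simp: upper_bidiagonal_def inner_add_left onb_inner[OF onb])
  qed
qed

text \<open>An ordinary eigenvalue problem becomes a pencil whose second member is the identity;
  this serves the four problems for V, W and their transposes.\<close>

lemma bidiagonal_ident:
  "lower_bidiagonal N ket (\<lambda>v. v) (\<lambda>_. 1) (\<lambda>_. 0)"
  "upper_bidiagonal N ket (\<lambda>v. v) (\<lambda>_. 1) (\<lambda>_. 0)"
  by (auto simp: lower_bidiagonal_def upper_bidiagonal_def linear_iff)

section \<open>Solving a bidiagonal pencil\<close>

text \<open>The definition describes columns, while eigenvector equations are compared row by row.
  Moving \<open>A\<close> to the other side of the scalar product gives the rows without expanding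
  \<open>v\<close> in the basis.\<close>

lemma lower_bidiagonal_coordinate:
  assumes onb: "is_orthonormal_basis N ket" and A: "lower_bidiagonal N ket A d s" and k: "k \<le> N"
  shows "A v \<bullet> ket k = d k * (v \<bullet> ket k) + (if 0 < k then s (k - 1) * (v \<bullet> ket (k - 1)) else 0)"
proof -
  have "A v \<bullet> ket k = v \<bullet> adjoint A (ket k)"
    using A by (simp add: lower_bidiagonal_def adjoint_works)
  also have "adjoint A (ket k) = d k *\<^sub>R ket k + (if 0 < k then s (k - 1) *\<^sub>R ket (k - 1) else 0)"
    using lower_bidiagonal_adjoint[OF onb A] k by (simp add: upper_bidiagonal_def)
  finally show ?thesis
    by (simp add: inner_add_right)
qed

text \<open>Coordinate \<open>Suc k\<close> of \<open>A w = l n *\<^sub>R B w\<close> is precisely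
  \<open>c_rec\<close>. At \<open>Suc k = n\<close> its left factor vanishes by \<open>diag\<close>
  and \<open>c n k\<close> by \<open>c_zero\<close>, so the product form is consistent where the
  vector starts; a quotient form would not be.\<close>

lemma gevp_solution_lower:
  fixes ket :: "nat \<Rightarrow> 'a::euclidean_space"
  assumes onb: "is_orthonormal_basis N ket"
    and A: "lower_bidiagonal N ket A dA sA" and B: "lower_bidiagonal N ket B dB sB"
    and diag: "\<And>k. k \<le> N \<Longrightarrow> dA k = l k * dB k" "\<And>k. k \<le> N \<Longrightarrow> dB k \<noteq> 0"
    and inj: "inj_on l {..N}"
    and c_diag: "\<And>n. n \<le> N \<Longrightarrow> c n n \<noteq> 0"
    and c_zero: "\<And>n k. n \<le> N \<Longrightarrow> k < n \<Longrightarrow> c n k = 0"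
    and c_rec: "\<And>n k. n \<le> N \<Longrightarrow> k < N \<Longrightarrow>
      (l n * dB (Suc k) - dA (Suc k)) * c n (Suc k) = (sA k - l n * sB k) * c n k"
  shows "gevp_solution A B N l (\<lambda>n. \<Sum>k\<le>N. c n k *\<^sub>R ket k)"
proof -
  define w where "w n = (\<Sum>k\<le>N. c n k *\<^sub>R ket k)" for n
  have w_coord: "w n \<bullet> ket k = c n k" if "k \<le> N" for n k
    using onb_coordinate[OF onb that] by (simp add: w_def)
  have linA: "linear A" and linB: "linear B"
    using A B by (auto simp: lower_bidiagonal_def)
  have w_eq: "A (w n) = l n *\<^sub>R B (w n)" if n: "n \<le> N" for n
  proof (rule onb_eqI[OF onb])
    fix k assume k: "k \<le> N"
    show "A (w n) \<bullet> ket k = (l n *\<^sub>R B (w n)) \<bullet> ket k"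
    proof (cases k)
      \<comment> \<open>The top coordinate is not covered by \<open>c_rec\<close>: for
        \<open>n = 0\<close> the diagonal entries match, otherwise \<open>c n 0\<close> is
        zero.\<close>
      case 0
      then show ?thesis
        using diag(1)[of 0] c_zero[OF n, of 0]
        by (cases "n = 0")
          (simp_all add: lower_bidiagonal_coordinate[OF onb A] lower_bidiagonal_coordinate[OF onb B] w_coord)
    next
      case (Suc j)
      then show ?thesis
        using c_rec[OF n, of j] k
        by (simp add: lower_bidiagonal_coordinate[OF onb A] lower_bidiagonal_coordinate[OF onb B] w_coord
            algebra_simps)
    qed
  qed
  have w_nz: "w n \<noteq> 0" if "n \<le> N" for n
    using c_diag[OF that] w_coord[OF that, of n] by auto
  have key: "\<exists>m\<le>N. v \<bullet> ket m \<noteq> 0 \<and> x = l m" if v: "v \<noteq> 0" "A v = x *\<^sub>R B v" for v x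
  proof -
    obtain k where k: "k \<le> N" "v \<bullet> ket k \<noteq> 0"
      using onb_eqI[OF onb, of v 0] v by auto
    define m where "m = (LEAST k. v \<bullet> ket k \<noteq> 0)"
    have m: "v \<bullet> ket m \<noteq> 0" "m \<le> N"
      unfolding m_def using k by (metis (mono_tags, lifting) LeastI, meson Least_le order_trans)
    have low: "v \<bullet> ket j = 0" if "j < m" for j
      using not_less_Least[of j "\<lambda>k. v \<bullet> ket k \<noteq> 0"] that unfolding m_def by blast
    have "A v \<bullet> ket m = x * (B v \<bullet> ket m)"
      using v by simp
    \<comment> \<open>The subdiagonal terms at \<open>m\<close> involve only coordinate
      \<open>m - 1\<close>, which is zero by minimality, or they are absent when
      \<open>m = 0\<close>.\<close>
    then have "dA m * (v \<bullet> ket m) = x * (dB m * (v \<bullet> ket m))"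
      using m low[of "m - 1"]
      by (simp add: lower_bidiagonal_coordinate[OF onb A] lower_bidiagonal_coordinate[OF onb B]
          split: if_splits)
    then have "x = l m"
      using m diag[of m] by simp
    with m show ?thesis by blast
  qed
  have "{x. gen_eigenvalue A B x} = l ` {..N}"
    using key w_eq w_nz by (fastforce simp: gen_eigenvalue_def gen_eigenvector_def)
  moreover have "{u. gen_eigenvector A B (l n) u} = {r *\<^sub>R w n | r. r \<noteq> 0}" if n: "n \<le> N" for n
  proof (intro equalityI subsetI)
    fix u assume "u \<in> {u. gen_eigenvector A B (l n) u}"
    then have u: "u \<noteq> 0" "A u = l n *\<^sub>R B u"
      by (auto simp: gen_eigenvector_def)
    define r where "r = (u \<bullet> ket n) / c n n"
    have "u - r *\<^sub>R w n = 0"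
    proof (rule ccontr)
      assume nz: "u - r *\<^sub>R w n \<noteq> 0"
      have "A (u - r *\<^sub>R w n) = l n *\<^sub>R B (u - r *\<^sub>R w n)"
        using u w_eq[OF n] linA linB by (simp add: linear_diff linear_scale scaleR_diff_right)
      from key[OF nz this] obtain m where m: "m \<le> N" "(u - r *\<^sub>R w n) \<bullet> ket m \<noteq> 0" "l n = l m"
        by blast
      \<comment> \<open>Distinctness of the scalars enters here: the only coordinate at which the
        difference could begin is \<open>n\<close>, and \<open>r\<close> was chosen to cancel
        it.\<close>
      then have "m = n"
        using inj n by (auto simp: inj_on_def)
      then show False
        using m c_diag[OF n] by (simp add: inner_diff_left w_coord[OF n] r_def)
    qed
    then have "u = r *\<^sub>R w n" "r \<noteq> 0"
      using u by auto
    then show "u \<in> {r *\<^sub>R w n | r. r \<noteq> 0}"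
      by blast
  next
    fix u assume "u \<in> {r *\<^sub>R w n | r. r \<noteq> 0}"
    then show "u \<in> {u. gen_eigenvector A B (l n) u}"
      using w_nz[OF n] w_eq[OF n] linA linB
      by (auto simp: gen_eigenvector_def linear_scale)
  qed
  ultimately have "gevp_solution A B N l w"
    by (simp add: gevp_solution_def)
  then show ?thesis
    by (simp add: w_def[abs_def])
qed

text \<open>The solution predicate depends only on which vector is paired with which scalar, and
  \<open>n \<mapsto> N - n\<close> is an involution of \<open>{..N}\<close>. Needed because
  reversing the basis also reverses the numbering of the eigenvalues.\<close>

lemma gevp_solution_reverse:
  assumes "gevp_solution A B N (\<lambda>n. l (N - n)) (\<lambda>n. v (N - n))"
  shows "gevp_solution A B N l v"
proof -
  have "(\<lambda>n. l (N - n)) ` {..N} = l ` {..N}"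
  proof (intro equalityI subsetI)
    fix y assume "y \<in> l ` {..N}"
    then obtain n where "n \<le> N" "y = l n" by auto
    then show "y \<in> (\<lambda>n. l (N - n)) ` {..N}"
      by (intro image_eqI[of _ _ "N - n"]) auto
  qed auto
  moreover have "{u. gen_eigenvector A B (l n) u} = {c *\<^sub>R v n |c. c \<noteq> 0}" if "n \<le> N" for n
  proof -
    have "{u. gen_eigenvector A B (l (N - (N - n))) u} = {c *\<^sub>R v (N - (N - n)) |c. c \<noteq> 0}"
      using assms unfolding gevp_solution_def by (meson diff_le_self)
    then show ?thesis
      using that by simp
  qed
  ultimately show ?thesis
    using assms by (simp add: gevp_solution_def)
qed

lemma gevp_solution_upper:
  fixes ket :: "nat \<Rightarrow> 'a::euclidean_space"
  assumes onb: "is_orthonormal_basis N ket"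
    and A: "upper_bidiagonal N ket A dA sA" and B: "upper_bidiagonal N ket B dB sB"
    and diag: "\<And>k. k \<le> N \<Longrightarrow> dA k = l k * dB k" "\<And>k. k \<le> N \<Longrightarrow> dB k \<noteq> 0"
    and inj: "inj_on l {..N}"
    and c_diag: "\<And>n. n \<le> N \<Longrightarrow> c n n \<noteq> 0"
    and c_zero: "\<And>n k. k \<le> N \<Longrightarrow> n < k \<Longrightarrow> c n k = 0"
    and c_rec: "\<And>n k. n \<le> N \<Longrightarrow> k < N \<Longrightarrow>
      (l n * dB k - dA k) * c n k = (sA k - l n * sB k) * c n (Suc k)"
  shows "gevp_solution A B N l (\<lambda>n. \<Sum>k\<le>N. c n k *\<^sub>R ket k)"
proof (rule gevp_solution_reverse)
  have "gevp_solution A B N (\<lambda>n. l (N - n)) (\<lambda>n. \<Sum>k\<le>N. c (N - n) (N - k) *\<^sub>R ket (N - k))"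
  proof (rule gevp_solution_lower[OF onb_reverse[OF onb]
        upper_bidiagonal_reverse[OF A] upper_bidiagonal_reverse[OF B]])
    show "inj_on (\<lambda>n. l (N - n)) {..N}"
    proof (rule inj_onI)
      fix x y assume "x \<in> {..N}" "y \<in> {..N}" "l (N - x) = l (N - y)"
      then have "N - x = N - y"
        using inj by (intro inj_onD[OF inj]) auto
      with \<open>x \<in> {..N}\<close> \<open>y \<in> {..N}\<close> show "x = y"
        by auto
    qed
    \<comment> \<open>The reversed recurrence at \<open>k\<close> is the given one at
      \<open>N - Suc k\<close>, whose successor is \<open>N - k\<close>.\<close>
    fix n k assume nk: "n \<le> N" "k < N"
    then show "(l (N - n) * dB (N - Suc k) - dA (N - Suc k)) * c (N - n) (N - Suc k)
        = (sA (N - Suc k) - l (N - n) * sB (N - Suc k)) * c (N - n) (N - k)"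
      using c_rec[of "N - n" "N - Suc k"] by (simp add: Suc_diff_Suc)
  qed (use diag c_diag c_zero in auto)
  moreover have "(\<Sum>k\<le>N. c (N - n) (N - k) *\<^sub>R ket (N - k)) = (\<Sum>k\<le>N. c (N - n) k *\<^sub>R ket k)" for n
    by (rule sum.reindex_bij_witness[of _ "\<lambda>k. N - k" "\<lambda>k. N - k"]) auto
  ultimately show "gevp_solution A B N (\<lambda>n. l (N - n)) (\<lambda>n. \<Sum>k\<le>N. c (N - n) k *\<^sub>R ket k)"
    by simp
qed

section \<open>Arithmetic with powers of q\<close>

lemma powr_eq_1_iff_pos:
  fixes q :: real
  assumes "q > 0" "q \<noteq> 1"
  shows "q powr x = 1 \<longleftrightarrow> x = 0"
  using assms by (auto simp: powr_def)

lemma powr_inj_pos: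
  fixes q :: real
  assumes "q > 0" "q \<noteq> 1"
  shows "q powr x = q powr y \<longleftrightarrow> x = y"
  using assms by (auto simp: powr_def)

lemma qpoch_Suc: "qpoch x q (Suc k) = qpoch x q k * (1 - x * q ^ k)"
  by (simp add: qpoch_def)

lemma qpoch_powr_Suc:
  assumes "q > 0"
  shows "qpoch (q powr x) q (Suc k) = qpoch (q powr x) q k * (1 - q powr (x + real k))"
  using assms by (simp add: qpoch_Suc powr_add powr_realpow)

text \<open>Each factor is 1 - q^(x+i), and q^y = 1 only for y = 0 since q is positive and different
  from 1. This converts nonvanishing denominators into linear conditions on exponents.\<close>

lemma qpoch_powr_eq_0_iff:
  assumes "q > 0" "q \<noteq> 1"
  shows "qpoch (q powr x) q k = 0 \<longleftrightarrow> (\<exists>i<k. x + real i = 0)"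
proof -
  have "1 - q powr x * q ^ i = 0 \<longleftrightarrow> x + real i = 0" for i
    using powr_eq_1_iff_pos[OF assms, of "x + real i"] assms by (auto simp: powr_add powr_realpow)
  then show ?thesis
    by (auto simp: qpoch_def)
qed

lemma qpoch_self_nonzero:
  assumes "q > 0" "q \<noteq> 1"
  shows "qpoch q q k \<noteq> 0"
  using qpoch_powr_eq_0_iff[OF assms, of 1 k] assms by simp

lemma qpoch_self_Suc:
  assumes "q > 0"
  shows "qpoch q q (Suc k) = qpoch q q k * (1 - q powr (real k + 1))"
  using qpoch_powr_Suc[OF assms, of 1 k] assms by (simp add: add.commute)

text \<open>Extracts the factor 1 - q^(x-y) that has to be matched with a factor of a q-shifted
  factorial. Which of the two powers is pulled out in front decides which power of q survives in the
  eigenvectors.\<close>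

lemma qnum_diff:
  assumes "q > 0"
  shows "qnum q x - qnum q y = q powr y * (1 - q powr (x - y)) / (1 - q)"
  using assms by (simp add: qnum_def powr_diff diff_divide_distrib[symmetric] right_diff_distrib)

lemma qnum_inj:
  assumes "q > 0" "q \<noteq> 1"
  shows "qnum q x = qnum q y \<longleftrightarrow> x = y"
  using assms powr_inj_pos[OF assms, of x y] by (auto simp: qnum_def)

text \<open>In (1 - q^(x-\<beta>))(1 - q^(\<beta>-x+1)) the two powers have product q, independent
  of x. Hence only their sums remain in the difference, and these factor.\<close>

lemma nu_diff:
  assumes "q > 0" "q \<noteq> 1"
  shows "qnum q (x - \<beta>) * qnum q (\<beta> - x + 1) - qnum q (y - \<beta>) * qnum q (\<beta> - y + 1)
    = - (q powr (\<beta> - x + 1)) * (1 - q powr (x - y)) * (1 - q powr (x + y - 2 * \<beta> - 1)) / (1 - q)\<^sup>2"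
proof -
  define A B C D P Q where
    "A = q powr (x - \<beta>)" and "B = q powr (\<beta> - x + 1)" and
    "C = q powr (y - \<beta>)" and "D = q powr (\<beta> - y + 1)" and
    "P = q powr (x - y)" and "Q = q powr (x + y - 2 * \<beta> - 1)"
  note defs = this
  \<comment> \<open>All four powers are expressed through \<open>B\<close>:
    \<open>D = B * P\<close>, \<open>C = B * Q\<close> and \<open>A = B * P * Q\<close>, which makes
    the factorization visible.\<close>
  have AB: "A * B = q" "C * D = q" and BP: "B * P = D" and BQ: "B * Q = C" and DQ: "D * Q = A"
    using assms(1) by (simp_all add: defs powr_add[symmetric] algebra_simps)
  have "(1 - A) * (1 - B) - (1 - C) * (1 - D) = C + D - A - B"
    using AB by (simp add: algebra_simps)
  also have "\<dots> = - B + B * P + B * Q - B * P * Q"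
    by (simp add: BP BQ DQ)
  also have "\<dots> = - B * (1 - P) * (1 - Q)"
    by (simp add: algebra_simps)
  finally show ?thesis
    by (simp add: qnum_def defs[symmetric] power2_eq_square diff_divide_distrib[symmetric])
qed

text \<open>Flips the sign of the exponent, to match factorials based on q^(-N), whose factors carry
  negative exponents.\<close>

lemma qnum_neg:
  assumes "q > 0"
  shows "qnum q x = - (q powr x * (1 - q powr (- x)) / (1 - q))"
  using assms by (simp add: qnum_def right_diff_distrib powr_add[symmetric] minus_divide_left)

section \<open>One-step ratios and zeros of the coefficient factors\<close>

text \<open>The factorials of length \<open>N - l\<close> grow as \<open>l\<close> decreases; the
  new factor, of index \<open>N - Suc k\<close>, appears when passing from \<open>Suc k\<close> down
  to \<open>k\<close>.\<close>

lemma qpoch_powr_rev_Suc: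
  assumes "q > 0" "k < N"
  shows "qpoch (q powr x) q (N - k)
    = qpoch (q powr x) q (N - Suc k) * (1 - q powr (x + (real N - real (Suc k))))"
proof -
  have "N - k = Suc (N - Suc k)"
    using assms by simp
  then show ?thesis
    using qpoch_powr_Suc[OF assms(1), of x "N - Suc k"] assms(2) by simp
qed

lemma qpoch_self_rev_Suc:
  assumes "q > 0" "k < N"
  shows "qpoch q q (N - k) = qpoch q q (N - Suc k) * (1 - q powr (real N - real k))"
  using qpoch_powr_rev_Suc[OF assms, of 1] assms by simp

text \<open>The integer exponent makes the factor of index \<open>n\<close> zero and no other. This
  truncates the vectors and shows that denominators of this kind do not vanish.\<close>

lemma qpoch_neg_eq_0_iff:
  assumes "q > 0" "q \<noteq> 1"
  shows "qpoch (q powr (- real n)) q k = 0 \<longleftrightarrow> n < k"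
  by (auto simp: qpoch_powr_eq_0_iff[OF assms])

lemma qpoch_neg_rev_eq_0_iff:
  assumes "q > 0" "q \<noteq> 1" "n \<le> N" "k \<le> N"
  shows "qpoch (q powr (real n - real N)) q (N - k) = 0 \<longleftrightarrow> k < n"
  using qpoch_neg_eq_0_iff[OF assms(1,2), of "N - n" "N - k"] assms(3,4)
  by auto

lemma powr_mult_Suc:
  fixes q :: real
  assumes "q > 0"
  shows "q powr (x * real (Suc k)) = q powr (x * real k) * q powr x"
  using assms by (simp add: powr_add[symmetric] algebra_simps)

lemma powr_mult_rev_Suc:
  fixes q :: real
  assumes "q > 0"
  shows "q powr (x * (real N - real k)) = q powr (x * (real N - real (Suc k))) * q powr x"
  using assms by (simp add: powr_add[symmetric] algebra_simps)

section \<open>Distinctness of the eigenvalues\<close>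

lemma inj_on_qnum:
  assumes "q > 0" "q \<noteq> 1"
  shows "inj_on (\<lambda>n. qnum q (\<alpha> - real n)) {..N}"
  using qnum_inj[OF assms] by (auto simp: inj_on_def)

lemma inj_on_rho:
  assumes "q > 0" "q \<noteq> 1"
  shows "inj_on (\<lambda>n. - qnum q (\<alpha> - real n) + qnum q \<mu>) {..N}"
  using inj_on_qnum[OF assms, of \<alpha> N] by (auto simp: inj_on_def)

text \<open>By \<open>nu_diff\<close> two eigenvalues with indices m < n can agree only if
  q^(m+n-2\<beta>-1) = 1. But 1 - q^(m+n-2\<beta>-1) is the factor of index m of
  (q^(n-2\<beta>-1);q)_n, a denominator of the n-th eigenvector of V.\<close>

lemma inj_on_nu:
  assumes q: "q > 0" "q \<noteq> 1"
    and nz: "\<And>n. n \<le> N \<Longrightarrow> qpoch (q powr (real n - 2 * \<beta> - 1)) q n \<noteq> 0"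
  shows "inj_on (\<lambda>n. qnum q (real n - \<beta>) * qnum q (\<beta> - real n + 1)) {..N}"
proof (rule linorder_inj_onI)
  fix m n assume mn: "m < n" "m \<in> {..N}" "n \<in> {..N}"
  have "real n - 2 * \<beta> - 1 + real m \<noteq> 0"
    using nz[of n] mn by (auto simp: qpoch_powr_eq_0_iff[OF q])
  then have "real m + real n - 2 * \<beta> - 1 \<noteq> 0"
    by (simp add: algebra_simps)
  then show "qnum q (real m - \<beta>) * qnum q (\<beta> - real m + 1)
      \<noteq> qnum q (real n - \<beta>) * qnum q (\<beta> - real n + 1)"
    using nu_diff[OF q, of "real m" \<beta> "real n"] mn q powr_eq_1_iff_pos[OF q] by auto
qed auto

section \<open>The six problems\<close>

text \<open>Both differences in the recurrence are taken against
  \<open>qnum q (\<alpha> - real n)\<close>, so the same power q^(\<alpha>-n) comes out of each and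
  cancels. Hence the vector carries no explicit power of q.\<close>

lemma gevp_d_vec:
  fixes ket :: "nat \<Rightarrow> 'a::euclidean_space"
  assumes q: "q > 0" "q \<noteq> 1"
    and onb: "is_orthonormal_basis N ket" and a: "\<forall>n<N. a n \<noteq> 0"
    and X: "lower_bidiagonal N ket X (\<lambda>n. - qnum q (\<alpha> - real n)) (\<lambda>n. a n * qnum q (\<beta> - real n))"
    and Z: "lower_bidiagonal N ket Z (\<lambda>n. - 1) a"
    and nz: "\<And>n l. n \<le> N \<Longrightarrow> l \<le> N \<Longrightarrow>
      qpoch (q powr (real n - real N - \<alpha> + \<beta> + 1)) q (N - l) \<noteq> 0"
  shows "gevp_solution X Z N (\<lambda>n. qnum q (\<alpha> - real n)) (d_vec q N \<alpha> \<beta> a ket)"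
proof -
  define c where "c n l =
     (\<Prod>i\<in>{n..<N}. a i) / (\<Prod>i\<in>{l..<N}. a i)
      * (qpoch (q powr (real n - real N)) q (N - l)
         / qpoch (q powr (real n - real N)) q (N - n))
      * (qpoch (q powr (real n - real N - \<alpha> + \<beta> + 1)) q (N - n)
         / qpoch (q powr (real n - real N - \<alpha> + \<beta> + 1)) q (N - l))" for n l
  have "gevp_solution X Z N (\<lambda>n. qnum q (\<alpha> - real n)) (\<lambda>n. \<Sum>l\<le>N. c n l *\<^sub>R ket l)"
  proof (rule gevp_solution_lower[OF onb X Z])
    show "c n n \<noteq> 0" if "n \<le> N" for n
      using that a nz[OF that that] by (simp add: c_def qpoch_neg_rev_eq_0_iff[OF q])
    show "c n k = 0" if "n \<le> N" "k < n" for n k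
      using that by (simp add: c_def qpoch_neg_rev_eq_0_iff[OF q])
    fix n k assume n: "n \<le> N" and k: "k < N"
    define u w where "u = q powr (real n - real (Suc k))" and "w = q powr (\<beta> - real k - (\<alpha> - real n))"
    have pu: "qpoch (q powr (real n - real N)) q (N - k)
        = qpoch (q powr (real n - real N)) q (N - Suc k) * (1 - u)"
      unfolding qpoch_powr_rev_Suc[OF q(1) k] by (simp add: u_def algebra_simps)
    have pw: "qpoch (q powr (real n - real N - \<alpha> + \<beta> + 1)) q (N - k)
        = qpoch (q powr (real n - real N - \<alpha> + \<beta> + 1)) q (N - Suc k) * (1 - w)"
      unfolding qpoch_powr_rev_Suc[OF q(1) k] by (simp add: w_def algebra_simps)
    \<comment> \<open>\<open>1 - w\<close> is the last factor of a nonvanishing factorial and may be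
      divided by. In contrast, \<open>1 - u\<close> vanishes at \<open>n = Suc k\<close>.\<close>
    have "1 - w \<noteq> 0"
      using nz[OF n, of k] k unfolding pw by auto
    then have step: "c n k * (a k * (1 - w)) = c n (Suc k) * (1 - u)"
      using a k unfolding c_def prod.atLeast_Suc_lessThan[OF k] pu pw by (simp add: ac_simps)
    have "\<alpha> - real (Suc k) - (\<alpha> - real n) = real n - real (Suc k)"
      by simp
    then have d1: "qnum q (\<alpha> - real (Suc k)) - qnum q (\<alpha> - real n) = q powr (\<alpha> - real n) * (1 - u) / (1 - q)"
      using qnum_diff[OF q(1), of "\<alpha> - real (Suc k)" "\<alpha> - real n"] by (simp only: u_def)
    have d2: "qnum q (\<beta> - real k) - qnum q (\<alpha> - real n) = q powr (\<alpha> - real n) * (1 - w) / (1 - q)"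
      unfolding w_def by (rule qnum_diff[OF q(1)])
    have "(qnum q (\<alpha> - real n) * - 1 - - qnum q (\<alpha> - real (Suc k))) * c n (Suc k)
        = (q powr (\<alpha> - real n) / (1 - q)) * (c n (Suc k) * (1 - u))"
      using d1 by simp
    also have "\<dots> = (a k * (qnum q (\<beta> - real k) - qnum q (\<alpha> - real n))) * c n k"
      unfolding d2 step[symmetric] by simp
    finally show "(qnum q (\<alpha> - real n) * - 1 - - qnum q (\<alpha> - real (Suc k))) * c n (Suc k)
        = (a k * qnum q (\<beta> - real k) - qnum q (\<alpha> - real n) * a k) * c n k"
      by (simp add: algebra_simps)
  qed (use inj_on_qnum[OF q] in auto)
  then show ?thesis
    by (simp add: d_vec_def[abs_def] c_def)
qed

text \<open>Here the factorials contain the opposite exponents, so the powers pulled out of the two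
  differences are q^(\<alpha>-k) and q^(\<beta>-k). Their ratio q^(\<beta>-\<alpha>) does not depend
  on k and accumulates to the explicit power in the vector.\<close>

lemma gevp_dstar_vec:
  fixes ket :: "nat \<Rightarrow> 'a::euclidean_space"
  assumes q: "q > 0" "q \<noteq> 1"
    and onb: "is_orthonormal_basis N ket" and a: "\<forall>n<N. a n \<noteq> 0"
    and X: "upper_bidiagonal N ket X (\<lambda>n. - qnum q (\<alpha> - real n)) (\<lambda>n. a n * qnum q (\<beta> - real n))"
    and Z: "upper_bidiagonal N ket Z (\<lambda>n. - 1) a"
    and nz: "\<And>n l. n \<le> N \<Longrightarrow> l \<le> N \<Longrightarrow> qpoch (q powr (- real n + \<alpha> - \<beta>)) q l \<noteq> 0"
  shows "gevp_solution X Z N (\<lambda>n. qnum q (\<alpha> - real n)) (dstar_vec q N \<alpha> \<beta> a ket)"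
proof -
  define c where "c n l =
     (\<Prod>i<n. a i) / (\<Prod>i<l. a i)
      * (q powr ((\<beta> - \<alpha>) * real n) / q powr ((\<beta> - \<alpha>) * real l))
      * (qpoch (q powr (- real n)) q l / qpoch (q powr (- real n)) q n)
      * (qpoch (q powr (- real n + \<alpha> - \<beta>)) q n
         / qpoch (q powr (- real n + \<alpha> - \<beta>)) q l)" for n l
  have "gevp_solution X Z N (\<lambda>n. qnum q (\<alpha> - real n)) (\<lambda>n. \<Sum>l\<le>N. c n l *\<^sub>R ket l)"
  proof (rule gevp_solution_upper[OF onb X Z])
    show "c n n \<noteq> 0" if "n \<le> N" for n
      using that a q(1) nz[OF that that] by (simp add: c_def qpoch_neg_eq_0_iff[OF q])
    show "c n k = 0" if "k \<le> N" "n < k" for n k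
      using that by (simp add: c_def qpoch_neg_eq_0_iff[OF q])
    fix n k assume n: "n \<le> N" and k: "k < N"
    define u w where "u = q powr (real k - real n)" and "w = q powr (\<alpha> - real n - (\<beta> - real k))"
    have pu: "qpoch (q powr (- real n)) q (Suc k) = qpoch (q powr (- real n)) q k * (1 - u)"
      unfolding qpoch_powr_Suc[OF q(1)] by (simp add: u_def algebra_simps)
    have pw: "qpoch (q powr (- real n + \<alpha> - \<beta>)) q (Suc k) = qpoch (q powr (- real n + \<alpha> - \<beta>)) q k * (1 - w)"
      unfolding qpoch_powr_Suc[OF q(1)] by (simp add: w_def algebra_simps)
    have "1 - w \<noteq> 0"
      using nz[OF n, of "Suc k"] k unfolding pw by auto
    then have step: "c n (Suc k) * (a k * (1 - w)) * q powr (\<beta> - \<alpha>) = c n k * (1 - u)"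
      using a k q(1) unfolding c_def pu pw powr_mult_Suc[OF q(1)] by (simp add: ac_simps)
    have d1: "qnum q (\<alpha> - real k) - qnum q (\<alpha> - real n) = - (q powr (\<alpha> - real k) * (1 - u) / (1 - q))"
      using qnum_diff[OF q(1), of "\<alpha> - real n" "\<alpha> - real k"] by (simp add: u_def)
    have d2: "qnum q (\<beta> - real k) - qnum q (\<alpha> - real n) = - (q powr (\<beta> - real k) * (1 - w) / (1 - q))"
      using qnum_diff[OF q(1), of "\<alpha> - real n" "\<beta> - real k"] by (simp add: w_def algebra_simps)
    have pow: "q powr (\<beta> - real k) = q powr (\<alpha> - real k) * q powr (\<beta> - \<alpha>)"
      by (simp add: powr_add[symmetric])
    have "(qnum q (\<alpha> - real n) * - 1 - - qnum q (\<alpha> - real k)) * c n k = (qnum q (\<alpha> - real k) - qnum q (\<alpha> - real n)) * c n k"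
      by (simp add: algebra_simps)
    also have "\<dots> = - (q powr (\<alpha> - real k) / (1 - q) * (c n k * (1 - u)))"
      unfolding d1 by simp
    also have "\<dots> = (a k * (qnum q (\<beta> - real k) - qnum q (\<alpha> - real n))) * c n (Suc k)"
      unfolding d2 step[symmetric] pow by simp
    finally show "(qnum q (\<alpha> - real n) * - 1 - - qnum q (\<alpha> - real k)) * c n k
        = (a k * qnum q (\<beta> - real k) - qnum q (\<alpha> - real n) * a k) * c n (Suc k)"
      by (simp add: algebra_simps)
  qed (use inj_on_qnum[OF q] in auto)
  then show ?thesis
    by (simp add: dstar_vec_def[abs_def] c_def)
qed

text \<open>The two factors of the eigenvalue difference produce the factorials in the numerator of
  the l-dependence; the q-numbers [k+1]_q and [N-k]_q of the off-diagonal entry produce (q;q)_l and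
  (q^(-N);q)_l in the denominator. As \<open>a k\<close> divides that entry, the products of
  \<open>a\<close> are inverted in comparison with X and Z.\<close>

lemma evp_e_vec:
  fixes ket :: "nat \<Rightarrow> 'a::euclidean_space"
  assumes q: "q > 0" "q \<noteq> 1"
    and onb: "is_orthonormal_basis N ket" and a: "\<forall>n<N. a n \<noteq> 0"
    and V: "upper_bidiagonal N ket V (\<lambda>n. qnum q (real n - \<beta>) * qnum q (\<beta> - real n + 1))
      (\<lambda>k. - (q powr (\<alpha> - real N) * qnum q (real k + 1) * qnum q (real N - real k) / a k))"
    and nz: "\<And>n. n \<le> N \<Longrightarrow> qpoch (q powr (real n - 2 * \<beta> - 1)) q n \<noteq> 0"
  shows "evp_solution V N (\<lambda>n. qnum q (real n - \<beta>) * qnum q (\<beta> - real n + 1)) (e_vec q N \<alpha> \<beta> a ket)"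
proof -
  define c where "c n l =
     (\<Prod>i<l. a i) / (\<Prod>i<n. a i)
      * (q powr ((\<alpha> - \<beta> - 1) * real n) / q powr ((\<alpha> - \<beta> - 1) * real l))
      * (qpoch (q powr (- real n)) q l / qpoch (q powr (- real n)) q n)
      * (qpoch q q n / qpoch q q l)
      * (qpoch (q powr (- real N)) q n / qpoch (q powr (- real N)) q l)
      * (qpoch (q powr (real n - 2 * \<beta> - 1)) q l
         / qpoch (q powr (real n - 2 * \<beta> - 1)) q n)" for n l
  have "evp_solution V N (\<lambda>n. qnum q (real n - \<beta>) * qnum q (\<beta> - real n + 1)) (\<lambda>n. \<Sum>l\<le>N. c n l *\<^sub>R ket l)"
    unfolding evp_solution_def
  proof (rule gevp_solution_upper[OF onb V bidiagonal_ident(2)])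
    show "c n n \<noteq> 0" if "n \<le> N" for n
      using that a q(1) nz[OF that] by (simp add: c_def qpoch_neg_eq_0_iff[OF q] qpoch_self_nonzero[OF q])
    show "c n k = 0" if "k \<le> N" "n < k" for n k
      using that by (simp add: c_def qpoch_neg_eq_0_iff[OF q])
    fix n k assume n: "n \<le> N" and k: "k < N"
    define u v w t where "u = q powr (real k - real n)" and "v = q powr (real k + real n - 2 * \<beta> - 1)"
      and "w = q powr (real k + 1)" and "t = q powr (real k - real N)"
    have pu: "qpoch (q powr (- real n)) q (Suc k) = qpoch (q powr (- real n)) q k * (1 - u)"
      unfolding qpoch_powr_Suc[OF q(1)] by (simp add: u_def algebra_simps)
    have pv: "qpoch (q powr (real n - 2 * \<beta> - 1)) q (Suc k)
        = qpoch (q powr (real n - 2 * \<beta> - 1)) q k * (1 - v)"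
      unfolding qpoch_powr_Suc[OF q(1)] by (simp add: v_def algebra_simps)
    have pw: "qpoch q q (Suc k) = qpoch q q k * (1 - w)"
      unfolding qpoch_self_Suc[OF q(1)] by (simp add: w_def)
    have pt: "qpoch (q powr (- real N)) q (Suc k) = qpoch (q powr (- real N)) q k * (1 - t)"
      unfolding qpoch_powr_Suc[OF q(1)] by (simp add: t_def algebra_simps)
    have nz': "1 - w \<noteq> 0" "1 - t \<noteq> 0"
      using k powr_eq_1_iff_pos[OF q] by (auto simp: w_def t_def)
    have step: "c n (Suc k) * (q powr (\<alpha> - \<beta> - 1) * (1 - w) * (1 - t)) / a k = c n k * ((1 - u) * (1 - v))"
      using a k q(1) nz'
      unfolding c_def pu pv pw pt powr_mult_Suc[OF q(1)] by (simp add: ac_simps)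
    \<comment> \<open>Balance of the leftover powers: one from the eigenvalue difference, one from
      flipping the exponent in [N-k]_q. It fixes the step q^(\<alpha>-\<beta>-1).\<close>
    have pow: "q powr (\<beta> - real k + 1) * q powr (\<alpha> - \<beta> - 1) = q powr (\<alpha> - real N) * q powr (real N - real k)"
      by (simp add: powr_add[symmetric])
    have d1: "qnum q (real N - real k) = - (q powr (real N - real k) * (1 - t) / (1 - q))"
      unfolding qnum_neg[OF q(1), of "real N - real k"] by (simp add: t_def)
    have d2: "qnum q (real k + 1) = (1 - w) / (1 - q)"
      by (simp add: qnum_def w_def)
    have d3: "qnum q (real n - \<beta>) * qnum q (\<beta> - real n + 1) - qnum q (real k - \<beta>) * qnum q (\<beta> - real k + 1)
        = q powr (\<beta> - real k + 1) * (1 - u) * (1 - v) / (1 - q)\<^sup>2"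
      using arg_cong[OF nu_diff[OF q, of "real k" \<beta> "real n"], of uminus] by (simp add: u_def v_def)
    have "(qnum q (real n - \<beta>) * qnum q (\<beta> - real n + 1) * 1
          - qnum q (real k - \<beta>) * qnum q (\<beta> - real k + 1)) * c n k
        = q powr (\<beta> - real k + 1) / (1 - q)\<^sup>2 * (c n k * ((1 - u) * (1 - v)))"
      unfolding mult_1_right d3 by simp
    also have "\<dots> = (q powr (\<beta> - real k + 1) * q powr (\<alpha> - \<beta> - 1)) / (1 - q)\<^sup>2 * (c n (Suc k) * ((1 - w) * (1 - t)) / a k)"
      unfolding step[symmetric] by simp
    also have "\<dots> = - (q powr (\<alpha> - real N) * qnum q (real k + 1) * qnum q (real N - real k) / a k) * c n (Suc k)"
      unfolding pow d1 d2 by (simp add: power2_eq_square ac_simps)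
    finally show "(qnum q (real n - \<beta>) * qnum q (\<beta> - real n + 1) * 1
          - qnum q (real k - \<beta>) * qnum q (\<beta> - real k + 1)) * c n k
        = (- (q powr (\<alpha> - real N) * qnum q (real k + 1) * qnum q (real N - real k) / a k)
          - qnum q (real n - \<beta>) * qnum q (\<beta> - real n + 1) * 0) * c n (Suc k)"
      by simp
  qed (use inj_on_nu[OF q nz] in auto)
  then show ?thesis
    by (simp add: e_vec_def[abs_def] c_def)
qed

text \<open>\<open>nz\<close> is needed for the eigenvalues to be distinct, \<open>nz'\<close> for
  the denominators of the vectors themselves. Relative to the problem for V, [k+1]_q and [N-k]_q
  exchange roles: now the former has its exponent flipped.\<close>

lemma evp_estar_vec:
  fixes ket :: "nat \<Rightarrow> 'a::euclidean_space"
  assumes q: "q > 0" "q \<noteq> 1"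
    and onb: "is_orthonormal_basis N ket" and a: "\<forall>n<N. a n \<noteq> 0"
    and V: "lower_bidiagonal N ket V (\<lambda>n. qnum q (real n - \<beta>) * qnum q (\<beta> - real n + 1))
      (\<lambda>k. - (q powr (\<alpha> - real N) * qnum q (real k + 1) * qnum q (real N - real k) / a k))"
    and nz: "\<And>n. n \<le> N \<Longrightarrow> qpoch (q powr (real n - 2 * \<beta> - 1)) q n \<noteq> 0"
    and nz': "\<And>n. n \<le> N \<Longrightarrow> qpoch (q powr (- real N - real n + 2 * \<beta> + 1)) q (N - n) \<noteq> 0"
  shows "evp_solution V N (\<lambda>n. qnum q (real n - \<beta>) * qnum q (\<beta> - real n + 1)) (estar_vec q N \<alpha> \<beta> a ket)"
proof -
  define c where "c n l =
     (\<Prod>i\<in>{l..<N}. a i) / (\<Prod>i\<in>{n..<N}. a i)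
      * (q powr ((\<alpha> + \<beta> - real N) * (real N - real n))
         / q powr ((\<alpha> + \<beta> - real N) * (real N - real l)))
      * (qpoch (q powr (real n - real N)) q (N - l)
         / qpoch (q powr (real n - real N)) q (N - n))
      * (qpoch q q (N - n) / qpoch q q (N - l))
      * (qpoch (q powr (- real N)) q (N - n) / qpoch (q powr (- real N)) q (N - l))
      * (qpoch (q powr (- real N - real n + 2 * \<beta> + 1)) q (N - l)
         / qpoch (q powr (- real N - real n + 2 * \<beta> + 1)) q (N - n))" for n l
  have "evp_solution V N (\<lambda>n. qnum q (real n - \<beta>) * qnum q (\<beta> - real n + 1)) (\<lambda>n. \<Sum>l\<le>N. c n l *\<^sub>R ket l)"
    unfolding evp_solution_def
  proof (rule gevp_solution_lower[OF onb V bidiagonal_ident(1)])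
    show "c n n \<noteq> 0" if "n \<le> N" for n
      using that a q(1) nz'[OF that] by (simp add: c_def qpoch_neg_rev_eq_0_iff[OF q] qpoch_neg_eq_0_iff[OF q] qpoch_self_nonzero[OF q])
    show "c n k = 0" if "n \<le> N" "k < n" for n k
      using that by (simp add: c_def qpoch_neg_rev_eq_0_iff[OF q])
    fix n k assume n: "n \<le> N" and k: "k < N"
    define u v w t where "u = q powr (real n - real (Suc k))" and "v = q powr (2 * \<beta> - real n - real k)"
      and "w = q powr (real N - real k)" and "t = q powr (- (real k + 1))"
    have pu: "qpoch (q powr (real n - real N)) q (N - k)
        = qpoch (q powr (real n - real N)) q (N - Suc k) * (1 - u)"
      unfolding qpoch_powr_rev_Suc[OF q(1) k] by (simp add: u_def algebra_simps)
    have pv: "qpoch (q powr (- real N - real n + 2 * \<beta> + 1)) q (N - k)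
        = qpoch (q powr (- real N - real n + 2 * \<beta> + 1)) q (N - Suc k) * (1 - v)"
      unfolding qpoch_powr_rev_Suc[OF q(1) k] by (simp add: v_def algebra_simps)
    have pw: "qpoch q q (N - k) = qpoch q q (N - Suc k) * (1 - w)"
      unfolding qpoch_self_rev_Suc[OF q(1) k] by (simp add: w_def)
    have pt: "qpoch (q powr (- real N)) q (N - k) = qpoch (q powr (- real N)) q (N - Suc k) * (1 - t)"
      unfolding qpoch_powr_rev_Suc[OF q(1) k] by (simp add: t_def algebra_simps)
    have wt: "1 - w \<noteq> 0" "1 - t \<noteq> 0"
      using k powr_eq_1_iff_pos[OF q] by (auto simp: w_def t_def)
    have step: "c n k * (q powr (\<alpha> + \<beta> - real N) * (1 - w) * (1 - t)) / a k
        = c n (Suc k) * ((1 - u) * (1 - v))"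
      using a k q(1) wt
      unfolding c_def pu pv pw pt prod.atLeast_Suc_lessThan[OF k] powr_mult_rev_Suc[OF q(1), of _ N k] by (simp add: ac_simps)
    have pow: "q powr (real k + 1 - \<beta>) * q powr (\<alpha> + \<beta> - real N) = q powr (\<alpha> - real N) * q powr (real k + 1)"
      by (simp add: powr_add[symmetric] algebra_simps)
    have d1: "qnum q (real k + 1) = - (q powr (real k + 1) * (1 - t) / (1 - q))"
      unfolding t_def by (rule qnum_neg[OF q(1)])
    have d2: "qnum q (real N - real k) = (1 - w) / (1 - q)"
      by (simp add: qnum_def w_def)
    \<comment> \<open>The eigenvalue difference contains 1 - 1/\<open>v\<close> rather than
      \<open>1 - v\<close>; the flip costs a sign and a power, which turns the leading
      q^(\<beta>-n+1) into q^(k+1-\<beta>).\<close>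
    have "1 - q powr (real n + real (Suc k) - 2 * \<beta> - 1) = - (q powr (real n + real k - 2 * \<beta>)) * (1 - v)"
      using q(1) by (simp add: v_def right_diff_distrib powr_add[symmetric] algebra_simps)
    moreover have "q powr (\<beta> - real n + 1) * q powr (real n + real k - 2 * \<beta>) = q powr (real k + 1 - \<beta>)"
      by (simp add: powr_add[symmetric] algebra_simps)
    ultimately have d3: "q powr (\<beta> - real n + 1) * (1 - q powr (real n + real (Suc k) - 2 * \<beta> - 1))
        = - (q powr (real k + 1 - \<beta>)) * (1 - v)"
      by (metis mult.assoc mult_minus_left mult_minus_right)
    have "(qnum q (real n - \<beta>) * qnum q (\<beta> - real n + 1) * 1
          - qnum q (real (Suc k) - \<beta>) * qnum q (\<beta> - real (Suc k) + 1)) * c n (Suc k)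
        = - ((q powr (\<beta> - real n + 1) * (1 - q powr (real n + real (Suc k) - 2 * \<beta> - 1)))
          * (1 - u) / (1 - q)\<^sup>2 * c n (Suc k))"
      unfolding mult_1_right nu_diff[OF q, of "real n" \<beta> "real (Suc k)"] u_def by simp
    also have "\<dots> = q powr (real k + 1 - \<beta>) / (1 - q)\<^sup>2 * (c n (Suc k) * ((1 - u) * (1 - v)))"
      unfolding d3 by simp
    also have "\<dots> = (q powr (real k + 1 - \<beta>) * q powr (\<alpha> + \<beta> - real N)) / (1 - q)\<^sup>2 * (c n k * ((1 - w) * (1 - t)) / a k)"
      unfolding step[symmetric] by simp
    also have "\<dots> = - (q powr (\<alpha> - real N) * qnum q (real k + 1) * qnum q (real N - real k) / a k) * c n k"
      unfolding pow d1 d2 by (simp add: power2_eq_square ac_simps)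
    finally show "(qnum q (real n - \<beta>) * qnum q (\<beta> - real n + 1) * 1
          - qnum q (real (Suc k) - \<beta>) * qnum q (\<beta> - real (Suc k) + 1)) * c n (Suc k)
        = (- (q powr (\<alpha> - real N) * qnum q (real k + 1) * qnum q (real N - real k) / a k)
          - qnum q (real n - \<beta>) * qnum q (\<beta> - real n + 1) * 0) * c n k"
      by simp
  qed (use inj_on_nu[OF q nz] in auto)
  then show ?thesis
    by (simp add: estar_vec_def[abs_def] c_def)
qed

text \<open>The identity has no off-diagonal entries, so the entry of W enters free of the
  eigenvalue and its factorial does not depend on n. The powers pulled out are q^(\<alpha>-n) and
  q^\<mu>, which gives the step q^(\<alpha>-\<mu>-n).\<close>

lemma evp_f_vec:
  fixes ket :: "nat \<Rightarrow> 'a::euclidean_space"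
  assumes q: "q > 0" "q \<noteq> 1"
    and onb: "is_orthonormal_basis N ket" and a: "\<forall>n<N. a n \<noteq> 0"
    and W: "lower_bidiagonal N ket W (\<lambda>n. - qnum q (\<alpha> - real n) + qnum q \<mu>) (\<lambda>n. a n * (qnum q (\<beta> - real n) - qnum q \<mu>))"
    and nz: "\<And>l. l \<le> N \<Longrightarrow> qpoch (q powr (\<beta> - \<mu> - real N + 1)) q (N - l) \<noteq> 0"
  shows "evp_solution W N (\<lambda>n. - qnum q (\<alpha> - real n) + qnum q \<mu>) (f_vec q N \<alpha> \<beta> \<mu> a ket)"
proof -
  define c where "c n l =
     (\<Prod>i\<in>{n..<N}. a i) / (\<Prod>i\<in>{l..<N}. a i)
      * (q powr ((\<alpha> - \<mu> - real n) * (real N - real l))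
         / q powr ((\<alpha> - \<mu> - real n) * (real N - real n)))
      * (qpoch (q powr (real n - real N)) q (N - l)
         / qpoch (q powr (real n - real N)) q (N - n))
      * (qpoch (q powr (\<beta> - \<mu> - real N + 1)) q (N - n)
         / qpoch (q powr (\<beta> - \<mu> - real N + 1)) q (N - l))" for n l
  have "evp_solution W N (\<lambda>n. - qnum q (\<alpha> - real n) + qnum q \<mu>) (\<lambda>n. \<Sum>l\<le>N. c n l *\<^sub>R ket l)"
    unfolding evp_solution_def
  proof (rule gevp_solution_lower[OF onb W bidiagonal_ident(1)])
    show "c n n \<noteq> 0" if "n \<le> N" for n
      using that a q(1) nz[OF that] by (simp add: c_def qpoch_neg_rev_eq_0_iff[OF q])
    show "c n k = 0" if "n \<le> N" "k < n" for n k
      using that by (simp add: c_def qpoch_neg_rev_eq_0_iff[OF q])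
    fix n k assume n: "n \<le> N" and k: "k < N"
    define u w where "u = q powr (real n - real (Suc k))" and "w = q powr (\<beta> - real k - \<mu>)"
    have pu: "qpoch (q powr (real n - real N)) q (N - k)
        = qpoch (q powr (real n - real N)) q (N - Suc k) * (1 - u)"
      unfolding qpoch_powr_rev_Suc[OF q(1) k] by (simp add: u_def algebra_simps)
    have pw: "qpoch (q powr (\<beta> - \<mu> - real N + 1)) q (N - k)
        = qpoch (q powr (\<beta> - \<mu> - real N + 1)) q (N - Suc k) * (1 - w)"
      unfolding qpoch_powr_rev_Suc[OF q(1) k] by (simp add: w_def algebra_simps)
    have "1 - w \<noteq> 0"
      using nz[of k] k unfolding pw by auto
    then have step: "c n k * (a k * (1 - w)) = q powr (\<alpha> - \<mu> - real n) * (c n (Suc k) * (1 - u))"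
      using a k unfolding c_def prod.atLeast_Suc_lessThan[OF k] pu pw powr_mult_rev_Suc[OF q(1), of _ N k] by (simp add: ac_simps)
    have "\<alpha> - real (Suc k) - (\<alpha> - real n) = real n - real (Suc k)"
      by simp
    then have d1: "qnum q (\<alpha> - real (Suc k)) - qnum q (\<alpha> - real n) = q powr (\<alpha> - real n) * (1 - u) / (1 - q)"
      using qnum_diff[OF q(1), of "\<alpha> - real (Suc k)" "\<alpha> - real n"] by (simp only: u_def)
    have d2: "qnum q (\<beta> - real k) - qnum q \<mu> = q powr \<mu> * (1 - w) / (1 - q)"
      unfolding w_def by (rule qnum_diff[OF q(1)])
    have pow: "q powr (\<alpha> - real n) = q powr \<mu> * q powr (\<alpha> - \<mu> - real n)"
      by (simp add: powr_add[symmetric])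
    have "((- qnum q (\<alpha> - real n) + qnum q \<mu>) * 1 - (- qnum q (\<alpha> - real (Suc k)) + qnum q \<mu>)) * c n (Suc k)
        = (q powr \<mu> / (1 - q)) * (q powr (\<alpha> - \<mu> - real n) * (c n (Suc k) * (1 - u)))"
      using d1 unfolding pow by simp
    also have "\<dots> = (a k * (qnum q (\<beta> - real k) - qnum q \<mu>)) * c n k"
      unfolding d2 step[symmetric] by simp
    finally show "((- qnum q (\<alpha> - real n) + qnum q \<mu>) * 1 - (- qnum q (\<alpha> - real (Suc k)) + qnum q \<mu>)) * c n (Suc k)
        = (a k * (qnum q (\<beta> - real k) - qnum q \<mu>) - (- qnum q (\<alpha> - real n) + qnum q \<mu>) * 0) * c n k"
      by simp
  qed (use inj_on_rho[OF q] in auto)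
  then show ?thesis
    by (simp add: f_vec_def[abs_def] c_def)
qed

text \<open>Pulling q^(\<beta>-k) instead of q^\<mu> out of [\<beta>-k]_q - [\<mu>]_q gives the base
  q^(\<mu>-\<beta>) and the same step q^(\<beta>-\<alpha>) as in the transposed pencil of X and
  Z.\<close>

lemma evp_fstar_vec:
  fixes ket :: "nat \<Rightarrow> 'a::euclidean_space"
  assumes q: "q > 0" "q \<noteq> 1"
    and onb: "is_orthonormal_basis N ket" and a: "\<forall>n<N. a n \<noteq> 0"
    and W: "upper_bidiagonal N ket W (\<lambda>n. - qnum q (\<alpha> - real n) + qnum q \<mu>) (\<lambda>n. a n * (qnum q (\<beta> - real n) - qnum q \<mu>))"
    and nz: "\<And>l. l \<le> N \<Longrightarrow> qpoch (q powr (\<mu> - \<beta>)) q l \<noteq> 0"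
  shows "evp_solution W N (\<lambda>n. - qnum q (\<alpha> - real n) + qnum q \<mu>) (fstar_vec q N \<alpha> \<beta> \<mu> a ket)"
proof -
  define c where "c n l =
     (\<Prod>i<n. a i) / (\<Prod>i<l. a i)
      * (q powr ((\<beta> - \<alpha>) * real n) / q powr ((\<beta> - \<alpha>) * real l))
      * (qpoch (q powr (- real n)) q l / qpoch (q powr (- real n)) q n)
      * (qpoch (q powr (\<mu> - \<beta>)) q n / qpoch (q powr (\<mu> - \<beta>)) q l)" for n l
  have "evp_solution W N (\<lambda>n. - qnum q (\<alpha> - real n) + qnum q \<mu>) (\<lambda>n. \<Sum>l\<le>N. c n l *\<^sub>R ket l)"
    unfolding evp_solution_def
  proof (rule gevp_solution_upper[OF onb W bidiagonal_ident(2)])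
    show "c n n \<noteq> 0" if "n \<le> N" for n
      using that a q(1) nz[OF that] by (simp add: c_def qpoch_neg_eq_0_iff[OF q])
    show "c n k = 0" if "k \<le> N" "n < k" for n k
      using that by (simp add: c_def qpoch_neg_eq_0_iff[OF q])
    fix n k assume n: "n \<le> N" and k: "k < N"
    define u w where "u = q powr (real k - real n)" and "w = q powr (\<mu> - (\<beta> - real k))"
    have pu: "qpoch (q powr (- real n)) q (Suc k) = qpoch (q powr (- real n)) q k * (1 - u)"
      unfolding qpoch_powr_Suc[OF q(1)] by (simp add: u_def algebra_simps)
    have pw: "qpoch (q powr (\<mu> - \<beta>)) q (Suc k) = qpoch (q powr (\<mu> - \<beta>)) q k * (1 - w)"
      unfolding qpoch_powr_Suc[OF q(1)] by (simp add: w_def algebra_simps)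
    have "1 - w \<noteq> 0"
      using nz[of "Suc k"] k unfolding pw by auto
    then have step: "c n (Suc k) * (a k * (1 - w)) * q powr (\<beta> - \<alpha>) = c n k * (1 - u)"
      using a k q(1) unfolding c_def pu pw powr_mult_Suc[OF q(1)] by (simp add: ac_simps)
    have d1: "qnum q (\<alpha> - real k) - qnum q (\<alpha> - real n) = - (q powr (\<alpha> - real k) * (1 - u) / (1 - q))"
      using qnum_diff[OF q(1), of "\<alpha> - real n" "\<alpha> - real k"] by (simp add: u_def)
    have d2: "qnum q (\<beta> - real k) - qnum q (\<mu>) = - (q powr (\<beta> - real k) * (1 - w) / (1 - q))"
      using qnum_diff[OF q(1), of "\<mu>" "\<beta> - real k"] by (simp add: w_def algebra_simps)
    have pow: "q powr (\<beta> - real k) = q powr (\<alpha> - real k) * q powr (\<beta> - \<alpha>)"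
      by (simp add: powr_add[symmetric])
    have "((- qnum q (\<alpha> - real n) + qnum q \<mu>) * 1 - (- qnum q (\<alpha> - real k) + qnum q \<mu>)) * c n k = (qnum q (\<alpha> - real k) - qnum q (\<alpha> - real n)) * c n k"
      by (simp add: algebra_simps)
    also have "\<dots> = - (q powr (\<alpha> - real k) / (1 - q) * (c n k * (1 - u)))"
      unfolding d1 by simp
    also have "\<dots> = (a k * (qnum q (\<beta> - real k) - qnum q (\<mu>))) * c n (Suc k)"
      unfolding d2 step[symmetric] pow by simp
    finally show "((- qnum q (\<alpha> - real n) + qnum q \<mu>) * 1 - (- qnum q (\<alpha> - real k) + qnum q \<mu>)) * c n k
        = (a k * (qnum q (\<beta> - real k) - qnum q \<mu>) - (- qnum q (\<alpha> - real n) + qnum q \<mu>) * 0) * c n (Suc k)"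
      by (simp add: algebra_simps)
  qed (use inj_on_rho[OF q] in auto)
  then show ?thesis
    by (simp add: fstar_vec_def[abs_def] c_def)
qed

theorem proposition4p1:
  fixes q \<alpha> \<beta> \<mu> :: real
    and N :: nat
    and a :: "nat \<Rightarrow> real"
    and ket :: "nat \<Rightarrow> 'a::euclidean_space"
    and Z X V W :: "'a \<Rightarrow> 'a"
  assumes "q > 0" and "q \<noteq> 1"
    and "N \<ge> 1"
    and "DIM('a) = N + 1"
    and "is_orthonormal_basis N ket"
    and "\<forall>n<N. a n \<noteq> 0"
    and "meta_qHahn_rep q N \<alpha> \<beta> a ket Z X V"
    and "W = (\<lambda>v. X v - qnum q \<mu> *\<^sub>R Z v)"
    and "nonvanishing_denominators q N \<alpha> \<beta> \<mu>"
  shows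
    "gevp_solution X Z N (\<lambda>n. qnum q (\<alpha> - real n)) (d_vec q N \<alpha> \<beta> a ket) \<and>
     gevp_solution (adjoint X) (adjoint Z) N (\<lambda>n. qnum q (\<alpha> - real n)) (dstar_vec q N \<alpha> \<beta> a ket) \<and>
     evp_solution V N (\<lambda>n. qnum q (real n - \<beta>) * qnum q (\<beta> - real n + 1)) (e_vec q N \<alpha> \<beta> a ket) \<and>
     evp_solution (adjoint V) N (\<lambda>n. qnum q (real n - \<beta>) * qnum q (\<beta> - real n + 1)) (estar_vec q N \<alpha> \<beta> a ket) \<and>
     evp_solution W N (\<lambda>n. - qnum q (\<alpha> - real n) + qnum q \<mu>) (f_vec q N \<alpha> \<beta> \<mu> a ket) \<and>
     evp_solution (adjoint W) N (\<lambda>n. - qnum q (\<alpha> - real n) + qnum q \<mu>) (fstar_vec q N \<alpha> \<beta> \<mu> a ket)"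
proof -
  note q = assms(1,2) and onb = assms(5) and a = assms(6)
  \<comment> \<open>For V the index is shifted by n = k + 1, since the entry linking k and k + 1 is
    stored at k: [n]_q, [N+1-n]_q and a_(n-1) become [k+1]_q, [N-k]_q and a_k.\<close>
  have X: "lower_bidiagonal N ket X (\<lambda>n. - qnum q (\<alpha> - real n)) (\<lambda>n. a n * qnum q (\<beta> - real n))"
    and Z: "lower_bidiagonal N ket Z (\<lambda>n. - 1) a"
    and V: "upper_bidiagonal N ket V (\<lambda>n. qnum q (real n - \<beta>) * qnum q (\<beta> - real n + 1))
      (\<lambda>k. - (q powr (\<alpha> - real N) * qnum q (real k + 1) * qnum q (real N - real k) / a k))"
    using assms(7) by (auto simp: meta_qHahn_rep_def lower_bidiagonal_def upper_bidiagonal_def diff_diff_eq2)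
  \<comment> \<open>The diagonal of Z is -1, so subtracting [\<mu>]_q Z adds [\<mu>]_q on the
    diagonal and subtracts it inside the subdiagonal entries.\<close>
  have W: "lower_bidiagonal N ket W (\<lambda>n. - qnum q (\<alpha> - real n) + qnum q \<mu>)
      (\<lambda>n. a n * (qnum q (\<beta> - real n) - qnum q \<mu>))"
    using X Z unfolding assms(8) lower_bidiagonal_def
    by (auto simp: linear_compose_sub linear_compose_scale_right scaleR_diff_left scaleR_add_left
        scaleR_add_right scaleR_diff_right right_diff_distrib mult.commute)
  have nz: "qpoch (q powr (real n - real N - \<alpha> + \<beta> + 1)) q (N - l) \<noteq> 0"
    "qpoch (q powr (- real n + \<alpha> - \<beta>)) q l \<noteq> 0" if "n \<le> N" "l \<le> N" for n l
    using assms(9) that by (auto simp: nonvanishing_denominators_def)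
  have nz': "qpoch (q powr (real n - 2 * \<beta> - 1)) q n \<noteq> 0"
    "qpoch (q powr (- real N - real n + 2 * \<beta> + 1)) q (N - n) \<noteq> 0"
    "qpoch (q powr (\<beta> - \<mu> - real N + 1)) q (N - n) \<noteq> 0"
    "qpoch (q powr (\<mu> - \<beta>)) q n \<noteq> 0" if "n \<le> N" for n
    using assms(9) that by (auto simp: nonvanishing_denominators_def)
  show ?thesis
    using gevp_d_vec[OF q onb a X Z nz(1)]
      gevp_dstar_vec[OF q onb a lower_bidiagonal_adjoint[OF onb X] lower_bidiagonal_adjoint[OF onb Z] nz(2)]
      evp_e_vec[OF q onb a V nz'(1)]
      evp_estar_vec[OF q onb a upper_bidiagonal_adjoint[OF onb V] nz'(1) nz'(2)]
      evp_f_vec[OF q onb a W nz'(3)]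
      evp_fstar_vec[OF q onb a lower_bidiagonal_adjoint[OF onb W] nz'(4)]
    by simp
qed

end
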